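(* Let $\hat D$ be a co-loopless Le-diagram of type $(k,n)$ and let $D$ be the filling produced from $\hat D$ by the algorithm described in the context. Then $D$ is a Le-diagram of type $(k+1,n)$.
   Context: Le-diagrams. For $0\le k\le n$, a Le-diagram of type $(k,n)$ is a filling of a Young diagram $\lambda$ (English convention, placed in the top-left corner of a $k\times(n-k)$ rectangle and fitting inside it) with symbols $0$ and $+$ such that no box containing $0$ has both a $+$ somewhere above it in its column and a $+$ somewhere to its left in its row. The south-east boundary of $\lambda$ is a lattice path of $n$ unit steps from the top-right to the bottom-left corner of the rectangle; label its steps $1,\dots,n$ in order. Labels of vertical steps are row labels (each of the $k$ rows, possibly of length $0$, gets the label of the vertical step at its right end); labels of horizontal steps are column labels. Box $(i,j)$ is the box in row $i$ and column $j$ (if it lies in $\lambda$; then $i<j$). "Below" means larger row label, "to the left" means larger column label. Decorated permutation $\hat\pi$ of $\hat D$: replace each $0$ by a crossing and each $+$ by an elbow (a pipe entering from the bottom exits to the left, one entering from the right exits at the top); label the north-west boundary so each row's left end carries its row label and each column's top carries its column label; the pipe from boundary step $i$ (moving left from a row label, up from a column label) exits at label $j$, and $\hat\pi(i)=j$; fixed points that are row labels are co-loops. $\hat D$ is co-loopless if $\hat\pi$ has no co-loops, equivalently every row of $\hat D$ is nonempty and contains a $+$. The algorithm. Let the row labels of $\hat D$ be $b_1<\dots<b_k$ and $a_n=\hat\pi(1)$ (a column label of $\hat D$). $D$ has the Young-diagram shape of type $(k+1,n)$ whose row labels are $\{b_1,\dots,b_k,a_n\}$. For a row $b_u$ of $\hat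 D$ let $L_u$ be the column label of the leftmost $+$ in row $b_u$ of $\hat D$; for row $a_n$ set $L=\infty$ and regard the corresponding row of $\hat D$ as consisting only of $0$'s. For a row $r$ of $D$ let $W(r)$ be the label of the next row of $D$ below $r$, or $n+1$ if $r$ is the last row. A $0$ in $\hat D$ is restricted if some box to its left in the same row contains $+$, unrestricted otherwise. For a row $r$ of $D$ and column $\ell$ of $D$: (i) $\hat D$ has $+$ at $(r,\ell)$ (never for $r=a_n$); (ii) there is a row label $b'>r$ of $\hat D$ with $+$ at $(b',\ell)$ in $\hat D$ such that every box $(b,\ell)$ of $\hat D$ with $b$ a row label, $r<b<b'$, contains an unrestricted $0$; (iii) every existing box $(b,\ell)$ of $\hat D$ with $b$ a row label of $\hat D$, $b>r$, contains an unrestricted $0$. Row types: (I) rows $b_u$ for which box $(b_u,a_n)$ of $\hat D$ does not exist or contains $0$; (II) rows $b_u$ with $+$ at $(b_u,a_n)$ in $\hat D$; (III) row $a_n$. For a row $r$ of type (I) or (III), with $L=L_u$ (resp. $\infty$) and $W=W(r)$, each box $(r,\ell)$ of $D$ gets: $+$ if $r<\ell<\min(W,L)$; if $W<\ell<L$, $+$ when (i), (ii) or (iii) holds and $0$ otherwise; $0$ if $\ell\ge L$. For a row $r=b_u$ of type (II): boxes with $\ell<a_n$ follow the type (I) rule; boxes with $\ell>a_n$ get $+$ exactly when $\hat D$ has $+$ at $(r,\ell)$, else $0$. *)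

theory Defs
  imports "HOL-Library.Extended_Nat"
begin

section \<open>Fillings of Young diagrams and the labels of their boundary\<close>

datatype symbol = Zero | Plus

text \<open>
  A filling consists of the number \<open>n\<close> of boundary steps, the Young diagram given by its list of
  row lengths from top to bottom (rows of length 0 included, so the list has length \<open>k\<close>), and the
  symbols, which are indexed by row label and column label. Only the values of \<open>entry\<close> at boxes of
  the diagram matter; everything below accesses \<open>entry\<close> at boxes only.
\<close>

record filling =
  steps :: nat
  shape :: "nat list"
  entry :: "nat \<Rightarrow> nat \<Rightarrow> symbol"

definition fits_rectangle :: "nat \<Rightarrow> nat \<Rightarrow> nat list \<Rightarrow> bool" where
  "fits_rectangle k n la \<longleftrightarrow>
     k \<le> n \<and> length la = k \<and> sorted_wrt (\<ge>) la \<and> (\<forall>l\<in>set la. l \<le> n - k)"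

datatype step = West | South

text \<open>
  \<open>boundary w la\<close> is the lattice path from the top right corner of a rectangle of width \<open>w\<close> along
  the south-east boundary of \<open>la\<close> to the bottom left corner.
\<close>

fun boundary :: "nat \<Rightarrow> nat list \<Rightarrow> step list" where
  "boundary w [] = replicate w West"
| "boundary w (l # la) = replicate (w - l) West @ South # boundary l la"

definition path :: "filling \<Rightarrow> step list" where
  "path D = boundary (steps D - length (shape D)) (shape D)"

text \<open>
  The labels are \<open>1, \<dots>, n\<close>, whereas positions in lists count from 0. Rows are listed from top to
  bottom, columns from left to right (hence by decreasing label).
\<close>

definition row_labels :: "filling \<Rightarrow> nat list" where
  "row_labels D = [i \<leftarrow> [1..<Suc (steps D)]. path D ! (i - 1) = South]"

definition col_labels :: "filling \<Rightarrow> nat list" where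
  "col_labels D = rev [j \<leftarrow> [1..<Suc (steps D)]. path D ! (j - 1) = West]"

definition box :: "filling \<Rightarrow> nat \<Rightarrow> nat \<Rightarrow> bool" where
  "box D i j \<longleftrightarrow>
     (\<exists>u c. u < length (shape D) \<and> c < shape D ! u \<and>
            i = row_labels D ! u \<and> j = col_labels D ! c)"

definition plus_at :: "filling \<Rightarrow> nat \<Rightarrow> nat \<Rightarrow> bool" where
  "plus_at D i j \<longleftrightarrow> box D i j \<and> entry D i j = Plus"

definition zero_at :: "filling \<Rightarrow> nat \<Rightarrow> nat \<Rightarrow> bool" where
  "zero_at D i j \<longleftrightarrow> box D i j \<and> entry D i j = Zero"

text \<open>Above means smaller row label, to the left means larger column label.\<close>

definition le_diagram :: "nat \<Rightarrow> nat \<Rightarrow> filling \<Rightarrow> bool" where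
  "le_diagram k n D \<longleftrightarrow>
     steps D = n \<and> fits_rectangle k n (shape D) \<and>
     (\<forall>i j. zero_at D i j \<longrightarrow>
        \<not> ((\<exists>i'<i. plus_at D i' j) \<and> (\<exists>j'>j. plus_at D i j')))"


section \<open>The decorated permutation\<close>

text \<open>
  A pipe heading west in row \<open>u\<close> (positions from 0) with \<open>c\<close> boxes of the row still to its left
  enters the box in column \<open>c - 1\<close> next; a pipe heading north in column \<open>c\<close> with \<open>u\<close> boxes of the
  column still above it enters the box in row \<open>u - 1\<close> next. The value is the label at which the
  pipe leaves the diagram.
\<close>

datatype heading = Westward | Northward

function pipe :: "filling \<Rightarrow> heading \<Rightarrow> nat \<Rightarrow> nat \<Rightarrow> nat" where
  "pipe D Westward u 0 = row_labels D ! u"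
| "pipe D Westward u (Suc c) =
     (case entry D (row_labels D ! u) (col_labels D ! c) of
        Zero \<Rightarrow> pipe D Westward u c
      | Plus \<Rightarrow> pipe D Northward u c)"
| "pipe D Northward 0 c = col_labels D ! c"
| "pipe D Northward (Suc u) c =
     (case entry D (row_labels D ! u) (col_labels D ! c) of
        Zero \<Rightarrow> pipe D Northward u c
      | Plus \<Rightarrow> pipe D Westward u c)"
  by pat_completeness auto
termination
  by (relation "Wellfounded.measure (\<lambda>(D, h, u, c). u + c)") auto

text \<open>
  Boundary step \<open>i\<close> has as many rows above it as there are vertical steps before it, and as many
  columns to its left as there are horizontal steps after it.
\<close>

definition perm :: "filling \<Rightarrow> nat \<Rightarrow> nat" where
  "perm D i =
     (let u = length (filter (\<lambda>s. s = South) (take (i - 1) (path D)));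
          c = length (filter (\<lambda>s. s = West) (drop i (path D)))
      in case path D ! (i - 1) of
           South \<Rightarrow> pipe D Westward u c
         | West \<Rightarrow> pipe D Northward u c)"

definition coloop :: "filling \<Rightarrow> nat \<Rightarrow> bool" where
  "coloop D i \<longleftrightarrow> i \<in> set (row_labels D) \<and> perm D i = i"

definition coloopless :: "filling \<Rightarrow> bool" where
  "coloopless D \<longleftrightarrow> (\<forall>i. \<not> coloop D i)"


section \<open>The algorithm\<close>

definition shape_of_row_labels :: "nat \<Rightarrow> nat set \<Rightarrow> nat list" where
  "shape_of_row_labels n R =
     map (\<lambda>i. card {j \<in> {1..n} - R. i < j}) (sorted_list_of_set R)"

lemma boundary_Suc:
  assumes "\<forall>l\<in>set la. l \<le> w"
  shows "boundary (Suc w) la = West # boundary w la"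
  using assms by (cases la) (auto simp: Suc_diff_le)

lemma boundary_row_labels:
  assumes "R \<subseteq> {a..<m}"
  shows "boundary (card ({a..<m} - R))
           (map (\<lambda>i. card {j \<in> {a..<m} - R. i < j}) (sorted_list_of_set R)) =
         map (\<lambda>i. if i \<in> R then South else West) [a..<m]"
  using assms
proof (induction "m - a" arbitrary: a R)
  case 0
  then show ?case by simp
next
  case (Suc d)
  then have am: "a < m" by simp
  have fin: "finite R" using Suc.prems finite_subset by blast
  let ?R = "R - {a}"
  have sub: "?R \<subseteq> {Suc a..<m}" using Suc.prems by force
  have IH: "boundary (card ({Suc a..<m} - ?R))
           (map (\<lambda>i. card {j \<in> {Suc a..<m} - ?R. i < j}) (sorted_list_of_set ?R)) =
         map (\<lambda>i. if i \<in> ?R then South else West) [Suc a..<m]"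
    using Suc.hyps(2) sub by (intro Suc.hyps(1)) simp_all
  have upt: "[a..<m] = a # [Suc a..<m]" using am by (simp add: upt_conv_Cons)
  have tail: "map (\<lambda>i. if i \<in> ?R then South else West) [Suc a..<m] =
              map (\<lambda>i. if i \<in> R then South else West) [Suc a..<m]" by auto
  have len: "map (\<lambda>i. card {j \<in> {a..<m} - R. i < j}) (sorted_list_of_set ?R) =
        map (\<lambda>i. card {j \<in> {Suc a..<m} - ?R. i < j}) (sorted_list_of_set ?R)"
    using sub fin by (intro map_cong refl arg_cong[where f = card]) force
  show ?case
  proof (cases "a \<in> R")
    case True
    have srt: "sorted_list_of_set R = a # sorted_list_of_set ?R"
    proof -
      have "R = insert a ?R" using True by auto
      moreover have "sorted_list_of_set (insert a ?R) = insort a (sorted_list_of_set ?R)"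
        using fin by (simp del: insert_Diff_single)
      moreover have "insort a (sorted_list_of_set ?R) = a # sorted_list_of_set ?R"
        using sub fin by (intro insort_is_Cons) auto
      ultimately show ?thesis by simp
    qed
    have eqs: "{j \<in> {a..<m} - R. a < j} = {Suc a..<m} - ?R" "{a..<m} - R = {Suc a..<m} - ?R"
      using True by (auto simp: Suc_le_eq order_le_less)
    have "boundary (card ({a..<m} - R))
           (map (\<lambda>i. card {j \<in> {a..<m} - R. i < j}) (sorted_list_of_set R)) =
        South # boundary (card ({Suc a..<m} - ?R))
           (map (\<lambda>i. card {j \<in> {a..<m} - R. i < j}) (sorted_list_of_set ?R))"
      unfolding srt list.map boundary.simps eqs(1) by (simp add: eqs(2))
    then show ?thesis unfolding len IH tail upt using True by simp
  next
    case False
    then have R: "?R = R" by simp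
    have "{a..<m} - R = insert a ({Suc a..<m} - R)" using am False by auto
    then have c: "card ({a..<m} - R) = Suc (card ({Suc a..<m} - R))" by simp
    have "\<forall>l\<in>set (map (\<lambda>i. card {j \<in> {Suc a..<m} - R. i < j}) (sorted_list_of_set R)).
            l \<le> card ({Suc a..<m} - R)"
      by (auto intro!: card_mono)
    then show ?thesis
      using IH len tail False unfolding R upt c by (simp only: boundary_Suc list.map if_False)
  qed
qed

text \<open>\<open>shape_of_row_labels n R\<close> is indeed the Young diagram with row labels \<open>R\<close>.\<close>

lemma fits_rectangle_shape_of_row_labels:
  assumes "R \<subseteq> {1..n}"
  shows "fits_rectangle (card R) n (shape_of_row_labels n R)"
proof -
  have fin: "finite R" using assms finite_subset by blast
  have "sorted_wrt (<) (sorted_list_of_set R)" by simp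
  then have "sorted_wrt (\<lambda>i i'. card {j \<in> {1..n} - R. i' < j} \<le> card {j \<in> {1..n} - R. i < j})
          (sorted_list_of_set R)"
    by (rule sorted_wrt_mono_rel[rotated]) (auto intro!: card_mono)
  moreover have "card {j \<in> {1..n} - R. i < j} \<le> n - card R" for i
  proof -
    have "card {j \<in> {1..n} - R. i < j} \<le> card ({1..n} - R)" by (auto intro!: card_mono)
    then show ?thesis using assms fin by (simp add: card_Diff_subset)
  qed
  moreover have "card R \<le> n" using card_mono[OF _ assms] by simp
  ultimately show ?thesis
    using fin by (auto simp: fits_rectangle_def shape_of_row_labels_def sorted_wrt_map)
qed

lemma row_labels_shape_of_row_labels:
  assumes "R \<subseteq> {1..n}" "steps D = n" "shape D = shape_of_row_labels n R"
  shows "row_labels D = sorted_list_of_set R"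
proof -
  have fin: "finite R" using assms(1) finite_subset by blast
  have iv: "{1..<Suc n} = {1..n}" by auto
  have "card ({1..n} - R) = n - card R" using assms fin by (simp add: card_Diff_subset)
  then have p: "path D = map (\<lambda>i. if i \<in> R then South else West) [1..<Suc n]"
    using boundary_row_labels[of R 1 "Suc n"] assms fin
    unfolding path_def shape_of_row_labels_def iv by simp
  have "row_labels D = [i \<leftarrow> [1..<Suc n]. i \<in> R]"
    unfolding row_labels_def assms(2) p
    by (intro filter_cong refl) (auto simp del: upt_Suc split: if_splits)
  also have "\<dots> = sorted_list_of_set R"
  proof (rule sorted_distinct_set_unique)
    show "set [i \<leftarrow> [1..<Suc n]. i \<in> R] = set (sorted_list_of_set R)"
      using assms(1) fin by auto
  qed (auto simp: sorted_filter[of id, simplified] simp del: upt_Suc)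
  finally show ?thesis .
qed

definition new_label :: "filling \<Rightarrow> nat" where
  "new_label Dh = perm Dh 1"

definition new_rows :: "filling \<Rightarrow> nat set" where
  "new_rows Dh = insert (new_label Dh) (set (row_labels Dh))"

definition leftmost :: "filling \<Rightarrow> nat \<Rightarrow> enat" where
  "leftmost Dh r =
     (if r = new_label Dh then \<infinity> else enat (Max {j. plus_at Dh r j}))"

definition next_row :: "filling \<Rightarrow> nat \<Rightarrow> nat" where
  "next_row Dh r =
     (if \<exists>r'\<in>new_rows Dh. r < r' then Min {r' \<in> new_rows Dh. r < r'} else steps Dh + 1)"

definition unrestricted_zero :: "filling \<Rightarrow> nat \<Rightarrow> nat \<Rightarrow> bool" where
  "unrestricted_zero Dh i j \<longleftrightarrow> zero_at Dh i j \<and> \<not> (\<exists>j'>j. plus_at Dh i j')"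

definition cond_i :: "filling \<Rightarrow> nat \<Rightarrow> nat \<Rightarrow> bool" where
  "cond_i Dh r l \<longleftrightarrow> plus_at Dh r l"

definition cond_ii :: "filling \<Rightarrow> nat \<Rightarrow> nat \<Rightarrow> bool" where
  "cond_ii Dh r l \<longleftrightarrow>
     (\<exists>b'>r. plus_at Dh b' l \<and>
        (\<forall>b. r < b \<and> b < b' \<and> box Dh b l \<longrightarrow> unrestricted_zero Dh b l))"

definition cond_iii :: "filling \<Rightarrow> nat \<Rightarrow> nat \<Rightarrow> bool" where
  "cond_iii Dh r l \<longleftrightarrow> (\<forall>b>r. box Dh b l \<longrightarrow> unrestricted_zero Dh b l)"

text \<open>
  The rule for rows of type (I) and (III). A column label \<open>l\<close> of the new diagram is never equal to
  \<open>next_row Dh r\<close>, and boxes with \<open>l \<ge> leftmost Dh r\<close> receive \<open>Zero\<close>.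
\<close>

definition type_I_III_entry :: "filling \<Rightarrow> nat \<Rightarrow> nat \<Rightarrow> symbol" where
  "type_I_III_entry Dh r l =
     (let L = leftmost Dh r; W = next_row Dh r in
      if r < l \<and> enat l < min (enat W) L then Plus
      else if W < l \<and> enat l < L \<and> (cond_i Dh r l \<or> cond_ii Dh r l \<or> cond_iii Dh r l) then Plus
      else Zero)"

text \<open>
  The rows of type (II) are those with \<open>plus_at Dh r (new_label Dh)\<close>; this excludes the row
  \<open>new_label Dh\<close>, which is not a row of \<open>Dh\<close>.
\<close>

definition new_entry :: "filling \<Rightarrow> nat \<Rightarrow> nat \<Rightarrow> symbol" where
  "new_entry Dh r l =
     (if plus_at Dh r (new_label Dh) \<and> new_label Dh < l
      then (if plus_at Dh r l then Plus else Zero)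
      else type_I_III_entry Dh r l)"

definition algorithm_output :: "filling \<Rightarrow> filling" where
  "algorithm_output Dh =
     \<lparr> steps = steps Dh,
       shape = shape_of_row_labels (steps Dh) (new_rows Dh),
       entry = new_entry Dh \<rparr>"

end

theory Submission
  imports Defs
begin

text \<open>
  Suppose a box of the new diagram contains \<open>Zero\<close> with a \<open>Plus\<close> to its left. Either way of
  filling its row then produces a restricted zero of the old diagram in the same column, weakly
  below the box. The old Le-condition forbids a \<open>Plus\<close> above the restricted zero, and the restricted
  zero itself blocks the conditions (ii) and (iii) for all rows above it; hence no box of the new
  diagram above the given one contains \<open>Plus\<close>. The absence of co-loops only serves to make the image
  of \<open>1\<close> a column label.
\<close>

section \<open>Boxes in terms of labels\<close>

lemma length_filter_West_boundary:
  assumes "sorted_wrt (\<ge>) la" "\<forall>l\<in>set la. l \<le> w"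
  shows "length (filter (\<lambda>s. s = West) (boundary w la)) = w"
  using assms by (induction w la rule: boundary.induct) auto

lemma length_boundary:
  assumes "sorted_wrt (\<ge>) la" "\<forall>l\<in>set la. l \<le> w"
  shows "length (boundary w la) = w + length la"
  using assms by (induction w la rule: boundary.induct) auto

text \<open>Positions count from 0, so these are the row labels minus one; this form admits
  recursion on the path.\<close>

definition south_positions :: "step list \<Rightarrow> nat list" where
  "south_positions q = filter (\<lambda>i. q ! i = South) [0..<length q]"

lemma south_positions_Cons:
  "south_positions (x # q) = (if x = South then [0] else []) @ map Suc (south_positions q)"
proof -
  have "[0..<length (x # q)] = 0 # map Suc [0..<length q]"
    by (simp add: upt_conv_Cons map_Suc_upt del: upt_Suc)
  then show ?thesis
    by (simp add: south_positions_def filter_map o_def del: upt_Suc)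
qed

text \<open>On a boundary path these are the row lengths: the columns meeting a row belong to the
  horizontal steps after its right end.\<close>

definition west_counts :: "step list \<Rightarrow> nat list" where
  "west_counts q =
     map (\<lambda>i. length (filter (\<lambda>s. s = West) (drop (Suc i) q))) (south_positions q)"

lemma west_counts_Nil: "west_counts [] = []"
  by (simp add: west_counts_def south_positions_def)

lemma west_counts_Cons:
  "west_counts (x # q) =
     (if x = South then [length (filter (\<lambda>s. s = West) q)] else []) @ west_counts q"
  by (simp add: west_counts_def south_positions_Cons o_def)

lemma west_counts_replicate_West: "west_counts (replicate m West @ q) = west_counts q"
  by (induction m) (simp_all add: west_counts_Cons)

text \<open>Leading \<open>West\<close> steps add no entry, and the path after the first
  \<open>South\<close> step is \<open>boundary l la\<close>, which has exactly \<open>l\<close>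
  steps \<open>West\<close>.\<close>

lemma west_counts_boundary:
  assumes "sorted_wrt (\<ge>) la" "\<forall>l\<in>set la. l \<le> w"
  shows "west_counts (boundary w la) = la"
  using assms
proof (induction w la rule: boundary.induct)
  case (1 w)
  show ?case using west_counts_replicate_West[of w "[]"] by (simp add: west_counts_Nil)
next
  case (2 w l la)
  then show ?case
    by (simp add: west_counts_replicate_West west_counts_Cons length_filter_West_boundary)
qed

text \<open>In a decreasing list the elements above a threshold form a prefix, so an index qualifies
  iff it is below the length of that prefix.\<close>

lemma nth_decreasing_greater_iff:
  fixes xs :: "'a::linorder list"
  assumes "sorted_wrt (>) xs" "c < length xs"
  shows "i < xs ! c \<longleftrightarrow> c < length (filter (\<lambda>j. i < j) xs)"
  using assms
proof (induction xs arbitrary: c)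
  case Nil
  then show ?case by simp
next
  case (Cons x xs)
  show ?case
  proof (cases "i < x")
    case True
    then show ?thesis using Cons by (cases c) auto
  next
    case False
    then have no: "\<forall>j\<in>set (x # xs). \<not> i < j" using Cons.prems(1) by auto
    have "(x # xs) ! c \<in> set (x # xs)" using Cons.prems(2) by (rule nth_mem)
    then have "\<not> i < (x # xs) ! c" using no by blast
    moreover have "filter (\<lambda>j. i < j) (x # xs) = []" using no by (simp add: filter_empty_conv)
    ultimately show ?thesis by simp
  qed
qed

section \<open>Row labels, column labels and the boxes between them\<close>

lemma step_neq_South_iff: "s \<noteq> South \<longleftrightarrow> s = West"
  by (cases s) auto

lemma set_row_labels_subset: "set (row_labels D) \<subseteq> {1..steps D}"
  by (auto simp: row_labels_def)

lemma set_col_labels: "set (col_labels D) = {1..steps D} - set (row_labels D)"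
  by (auto simp: row_labels_def col_labels_def step_neq_South_iff simp del: upt_Suc)

lemma col_labels_decreasing: "sorted_wrt (>) (col_labels D)"
proof -
  have "sorted_wrt (<) [j \<leftarrow> [1..<Suc (steps D)]. path D ! (j - 1) = West]"
    by (rule sorted_wrt_filter) (simp del: upt_Suc)
  then show ?thesis by (simp add: col_labels_def sorted_wrt_rev del: upt_Suc)
qed

context
  fixes D :: filling and k n :: nat
  assumes steps: "steps D = n" and fits: "fits_rectangle k n (shape D)"
begin

lemma shape_decreasing: "sorted_wrt (\<ge>) (shape D)"
  and shape_le: "\<forall>l\<in>set (shape D). l \<le> n - k"
  and length_shape: "length (shape D) = k"
  and height_le: "k \<le> n"
  using fits by (auto simp: fits_rectangle_def)

lemma path_eq_boundary: "path D = boundary (n - k) (shape D)"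
  by (simp add: path_def steps length_shape)

lemma length_path: "length (path D) = n"
  using length_boundary[OF shape_decreasing shape_le] height_le
  by (simp add: path_eq_boundary length_shape)

lemma length_filter_West_path: "length (filter (\<lambda>s. s = West) (path D)) = n - k"
  using length_filter_West_boundary[OF shape_decreasing shape_le] by (simp add: path_eq_boundary)

lemma row_labels_eq_map: "row_labels D = map Suc (south_positions (path D))"
proof -
  have "[1..<Suc n] = map Suc [0..<n]" by (simp add: map_Suc_upt del: upt_Suc)
  then show ?thesis
    by (simp add: row_labels_def south_positions_def steps length_path filter_map o_def
        del: upt_Suc)
qed

lemma shape_eq_map_row_labels:
  "shape D = map (\<lambda>i. length (filter (\<lambda>s. s = West) (drop i (path D)))) (row_labels D)"
  using west_counts_boundary[OF shape_decreasing shape_le]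
  by (simp add: row_labels_eq_map west_counts_def path_eq_boundary o_def)

lemma length_row_labels: "length (row_labels D) = k"
  using arg_cong[OF shape_eq_map_row_labels, of length] length_shape by simp

lemma card_row_labels: "card (set (row_labels D)) = k"
proof -
  have "distinct (row_labels D)" by (simp add: row_labels_def del: upt_Suc)
  then show ?thesis by (simp add: distinct_card length_row_labels)
qed

lemma length_filter_col_labels:
  assumes "i \<le> n"
  shows "length (filter (\<lambda>j. i < j) (col_labels D)) =
         length (filter (\<lambda>s. s = West) (drop i (path D)))"
proof -
  have split: "[1..<Suc n] = [1..<Suc i] @ [Suc i..<Suc n]"
    using assms upt_add_eq_append[of 1 "Suc i" "n - i"] by (simp del: upt_Suc)
  have "filter (\<lambda>j. i < j) (filter (\<lambda>j. path D ! (j - 1) = West) [1..<Suc n]) =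
        filter (\<lambda>j. path D ! (j - 1) = West) [Suc i..<Suc n]"
  proof -
    have "filter (\<lambda>j. i < j \<and> path D ! (j - 1) = West) [1..<Suc i] = []"
      by (auto simp: filter_empty_conv simp del: upt_Suc)
    moreover have "filter (\<lambda>j. i < j \<and> path D ! (j - 1) = West) [Suc i..<Suc n] =
        filter (\<lambda>j. path D ! (j - 1) = West) [Suc i..<Suc n]"
      by (rule filter_cong) auto
    ultimately show ?thesis unfolding split by (simp add: conj_commute del: upt_Suc)
  qed
  moreover have "drop i (path D) = map (\<lambda>j. path D ! (j - 1)) [Suc i..<Suc n]"
    by (rule nth_equalityI) (simp_all add: length_path del: upt_Suc)
  moreover have "filter P (rev xs) = rev (filter P xs)" for P and xs :: "nat list"
    by (simp add: rev_filter)
  ultimately show ?thesis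
    unfolding col_labels_def steps by (simp only: length_rev length_map filter_map o_def)
qed

lemma length_col_labels: "length (col_labels D) = n - k"
proof -
  have "filter (\<lambda>j. 0 < j) (col_labels D) = col_labels D"
    by (auto simp: filter_id_conv set_col_labels)
  then show ?thesis
    using length_filter_col_labels[of 0] by (simp add: length_filter_West_path)
qed

text \<open>The length of a row is the number of column labels exceeding its label, and as columns
  are listed decreasingly these come first. All later arguments use labels instead of
  positions.\<close>

lemma box_iff: "box D i j \<longleftrightarrow> i \<in> set (row_labels D) \<and> j \<in> set (col_labels D) \<and> i < j"
proof -
  have row: "row_labels D ! u < col_labels D ! c \<longleftrightarrow> c < shape D ! u"
    if "u < k" "c < n - k" for u c
  proof -
    have "row_labels D ! u \<in> set (row_labels D)"
      using that by (simp add: length_row_labels)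
    then have "row_labels D ! u \<le> n"
      using set_row_labels_subset[of D] steps by auto
    moreover have "shape D ! u =
        length (filter (\<lambda>s. s = West) (drop (row_labels D ! u) (path D)))"
      using that by (subst shape_eq_map_row_labels) (simp add: length_row_labels)
    ultimately show ?thesis
      using that nth_decreasing_greater_iff[OF col_labels_decreasing, of c D "row_labels D ! u"]
      by (simp add: length_filter_col_labels length_col_labels)
  qed
  have "c < n - k" if "u < k" "c < shape D ! u" for u c
    using that shape_le nth_mem[of u "shape D"] by (fastforce simp: length_shape)
  then have "box D i j \<longleftrightarrow>
      (\<exists>u<k. \<exists>c<n - k. i = row_labels D ! u \<and> j = col_labels D ! c \<and> i < j)"
    unfolding box_def length_shape using row by blast
  also have "\<dots> \<longleftrightarrow> i \<in> set (row_labels D) \<and> j \<in> set (col_labels D) \<and> i < j"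
    by (auto simp: in_set_conv_nth length_row_labels length_col_labels)
  finally show ?thesis .
qed

end


section \<open>The new row label\<close>

text \<open>A pipe in the top row either crosses to its left end or turns north at some elbow, and
  then leaves at once because no row lies above.\<close>

lemma pipe_Westward_top_row:
  "pipe D Westward 0 c = row_labels D ! 0 \<or> (\<exists>c'<c. pipe D Westward 0 c = col_labels D ! c')"
  by (induction c) (auto split: symbol.split intro: less_SucI)

lemma new_label_in_col_labels:
  assumes "n \<ge> 1" "steps D = n" "fits_rectangle k n (shape D)" "coloopless D"
  shows "new_label D \<in> set (col_labels D)"
proof -
  note len = length_path[OF assms(2,3)] length_filter_West_path[OF assms(2,3)]
    length_col_labels[OF assms(2,3)]
  obtain s q where q: "path D = s # q" using len(1) assms(1) by (cases "path D") auto
  show ?thesis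
  proof (cases s)
    case West
    \<comment> \<open>Step 1 is horizontal, so its column has no box and the pipe exits immediately;
      the bound makes its column index valid.\<close>
    then have "length (filter (\<lambda>s. s = West) q) < length (col_labels D)" using len q by simp
    then show ?thesis using West q by (simp add: new_label_def perm_def)
  next
    case South
    have rows: "row_labels D = 1 # map Suc (map Suc (south_positions q))"
      using row_labels_eq_map[OF assms(2,3)] q South by (simp add: south_positions_Cons)
    have perm: "perm D 1 = pipe D Westward 0 (n - k)"
      using South q len by (simp add: perm_def)
    \<comment> \<open>Here 1 labels the top row, so leaving at the left end of that row would be a
      co-loop.\<close>
    have "perm D 1 \<noteq> 1"
      using assms(4) rows by (auto simp: coloopless_def coloop_def)
    then obtain c' where "c' < n - k" "perm D 1 = col_labels D ! c'"
      using pipe_Westward_top_row[of D "n - k"] rows unfolding perm by auto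
    then show ?thesis using len by (simp add: new_label_def)
  qed
qed


section \<open>The algorithm\<close>

lemma finite_new_rows: "finite (new_rows D)"
  by (simp add: new_rows_def)

lemma next_row_le:
  assumes "r \<in> new_rows D" "r' < r"
  shows "next_row D r' \<le> r"
  using assms finite_new_rows[of D] by (auto simp: next_row_def)

text \<open>Ensures that \<open>next_row D r\<close> is never a column label of the new
  diagram.\<close>

lemma next_row_cases: "next_row D r \<in> new_rows D \<or> next_row D r = steps D + 1"
proof (cases "\<exists>r'\<in>new_rows D. r < r'")
  case True
  then have "Min {r' \<in> new_rows D. r < r'} \<in> {r' \<in> new_rows D. r < r'}"
    using finite_new_rows[of D] by (intro Min_in) auto
  then show ?thesis using True by (simp add: next_row_def)
qed (simp add: next_row_def)

section \<open>Restricted zeros and what they exclude above them\<close>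

definition restricted_zero :: "filling \<Rightarrow> nat \<Rightarrow> nat \<Rightarrow> bool" where
  "restricted_zero D i j \<longleftrightarrow> zero_at D i j \<and> (\<exists>j'>j. plus_at D i j')"

lemma restricted_zeroI:
  assumes "box D i j" "\<not> plus_at D i j" "\<not> unrestricted_zero D i j"
  shows "restricted_zero D i j"
  using assms by (cases "entry D i j")
    (auto simp: restricted_zero_def unrestricted_zero_def zero_at_def plus_at_def)

lemma restricted_zero_if_not_conds:
  assumes "\<not> cond_ii D r l" "\<not> cond_iii D r l"
  shows "\<exists>b>r. restricted_zero D b l"
proof -
  let ?P = "\<lambda>b. b > r \<and> box D b l \<and> \<not> unrestricted_zero D b l"
  \<comment> \<open>The topmost box violating (iii); a \<open>Plus\<close> in it would witness (ii),
    so it holds a restricted zero.\<close>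
  let ?b = "LEAST b. ?P b"
  have b: "?P ?b" using assms(2) LeastI_ex[of ?P] by (auto simp: cond_iii_def)
  have "unrestricted_zero D b l" if "r < b" "b < ?b" "box D b l" for b
    using that not_less_Least[of b ?P] by blast
  then have "\<not> plus_at D ?b l" using assms(1) b unfolding cond_ii_def by blast
  then show ?thesis using b restricted_zeroI by blast
qed

lemma not_plus_above_restricted_zero:
  assumes "le_diagram k n D" "restricted_zero D b l" "r \<le> b"
  shows "\<not> plus_at D r l"
proof (cases "r = b")
  case True
  then show ?thesis using assms(2) by (simp add: restricted_zero_def zero_at_def plus_at_def)
next
  case False
  then have "r < b" using assms(3) by simp
  then show ?thesis using assms(1,2) unfolding le_diagram_def restricted_zero_def by blast
qed

lemma not_conds_above_restricted_zero:
  assumes "le_diagram k n D" "restricted_zero D b l" "r < b"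
  shows "\<not> cond_i D r l" "\<not> cond_ii D r l" "\<not> cond_iii D r l"
proof -
  have b: "box D b l" "\<not> unrestricted_zero D b l"
    using assms(2) by (auto simp: restricted_zero_def unrestricted_zero_def zero_at_def)
  note no_plus = not_plus_above_restricted_zero[OF assms(1,2)]
  show "\<not> cond_i D r l" using no_plus assms(3) by (simp add: cond_i_def)
  show "\<not> cond_ii D r l"
    \<comment> \<open>A witness \<open>b'\<close> of (ii) with \<open>b' \<le> b\<close> would be a
      forbidden \<open>Plus\<close>; one with \<open>b' > b\<close> would force the zero in row
      \<open>b\<close> to be unrestricted.\<close>
    using no_plus b assms(3) unfolding cond_ii_def by (meson not_le)
  show "\<not> cond_iii D r l" using b assms(3) by (auto simp: cond_iii_def)
qed

text \<open>The bound on \<open>next_row D r\<close> rules out the unconditional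
  \<open>Plus\<close>. What remains is a copied old entry or the conditions (i) to (iii), all
  excluded by the restricted zero.\<close>

lemma new_entry_above_restricted_zero:
  assumes "le_diagram k n D" "restricted_zero D b l" "r < b" "next_row D r \<le> l"
  shows "new_entry D r l = Zero"
  using not_plus_above_restricted_zero[OF assms(1,2)] not_conds_above_restricted_zero[OF assms(1-3)]
    assms(3,4)
  by (simp add: new_entry_def type_I_III_entry_def Let_def)

lemma type_I_III_entry_PlusD: "type_I_III_entry D r l = Plus \<Longrightarrow> enat l < leftmost D r"
  by (auto simp: type_I_III_entry_def Let_def split: if_splits)

lemma less_leftmost_if_plus:
  assumes "plus_at D r (new_label D)" "r \<noteq> new_label D" "finite {j. plus_at D r j}"
    "l < new_label D"
  shows "enat l < leftmost D r"
proof -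
  have "new_label D \<le> Max {j. plus_at D r j}" using assms by (intro Max_ge) auto
  then have "l < Max {j. plus_at D r j}" using assms(4) by simp
  then show ?thesis using assms(2) by (simp add: leftmost_def)
qed

theorem mainTheorem9:
  fixes k n :: nat and Dh :: filling
  assumes "n \<ge> 1"
    and "le_diagram k n Dh"
    and "coloopless Dh"
  shows "le_diagram (k + 1) n (algorithm_output Dh)"
proof -
  let ?a = "new_label Dh" and ?D = "algorithm_output Dh"
  have steps: "steps Dh = n" and fits: "fits_rectangle k n (shape Dh)"
    using assms(2) by (auto simp: le_diagram_def)
  note box_Dh = box_iff[OF steps fits]
  have a: "?a \<in> set (col_labels Dh)"
    using new_label_in_col_labels assms(1,3) steps fits by blast
  have rows_sub: "new_rows Dh \<subseteq> {1..n}"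
    using a set_row_labels_subset[of Dh] steps by (auto simp: new_rows_def set_col_labels)
  have card: "card (new_rows Dh) = k + 1"
    using a by (simp add: new_rows_def set_col_labels card_row_labels[OF steps fits])
  have steps': "steps ?D = n" and shape': "shape ?D = shape_of_row_labels n (new_rows Dh)"
    and entry': "entry ?D = new_entry Dh"
    by (simp_all add: algorithm_output_def steps)
  have fits': "fits_rectangle (k + 1) n (shape ?D)"
    using fits_rectangle_shape_of_row_labels[OF rows_sub] card shape' by simp
  have rows': "set (row_labels ?D) = new_rows Dh"
    using row_labels_shape_of_row_labels[OF rows_sub steps' shape'] finite_new_rows by simp
  have box': "box ?D i j \<longleftrightarrow> i \<in> new_rows Dh \<and> j \<in> {1..n} - new_rows Dh \<and> i < j" for i j
    using box_iff[OF steps' fits'] by (simp add: set_col_labels rows' steps')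
  have finite_plus: "finite {j. plus_at Dh r j}" for r
    by (rule finite_subset[of _ "set (col_labels Dh)"]) (auto simp: plus_at_def box_Dh)
  have blocked: "\<exists>b\<ge>r. restricted_zero Dh b l"
    if zero: "zero_at ?D r l" and left: "l < l'" "plus_at ?D r l'" for r l l'
  proof -
    have l: "l \<in> {1..n}" "l \<notin> new_rows Dh" "r < l"
      using zero by (auto simp: zero_at_def box')
    have entries: "new_entry Dh r l = Zero" "new_entry Dh r l' = Plus"
      using zero left by (auto simp: zero_at_def plus_at_def entry')
    show ?thesis
    proof (cases "plus_at Dh r ?a \<and> ?a < l")
      case True
      then have "\<not> plus_at Dh r l" "plus_at Dh r l'"
        using entries left by (auto simp: new_entry_def split: if_splits)
      \<comment> \<open>The \<open>Plus\<close> at \<open>?a\<close> makes \<open>r\<close> an old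
        row, and \<open>l\<close>, being no new row label, is an old column label.\<close>
      moreover have "box Dh r l"
        using True l steps by (auto simp: plus_at_def box_Dh set_col_labels new_rows_def)
      ultimately have "restricted_zero Dh r l"
        using left by (intro restricted_zeroI) (auto simp: unrestricted_zero_def)
      then show ?thesis by blast
    next
      case False
      then have zero_l: "type_I_III_entry Dh r l = Zero"
        using entries(1) by (simp add: new_entry_def split: if_splits)
      \<comment> \<open>So the \<open>Zero\<close> is not caused by lying at or beyond the leftmost
        \<open>Plus\<close>. If \<open>l'\<close> is in the copied part of a type (II) row, then
        \<open>l < ?a\<close> and the old \<open>Plus\<close> at \<open>?a\<close> bounds
        \<open>l\<close>; otherwise \<open>l'\<close> itself lies before
        \<open>leftmost Dh r\<close>.\<close>
      have lt: "enat l < leftmost Dh r"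
      proof (cases "plus_at Dh r ?a \<and> ?a < l'")
        case True
        then have "r \<noteq> ?a" by (auto simp: plus_at_def box_Dh)
        moreover have "l \<noteq> ?a" using l by (auto simp: new_rows_def)
        ultimately show ?thesis
          using True False finite_plus by (intro less_leftmost_if_plus) auto
      next
        case False
        then have "type_I_III_entry Dh r l' = Plus" using entries by (auto simp: new_entry_def)
        then have "enat l' < leftmost Dh r" by (rule type_I_III_entry_PlusD)
        then show ?thesis using left(1) by (metis enat_ord_simps(2) less_trans)
      qed
      have "l \<noteq> next_row Dh r" using next_row_cases[of Dh r] l steps by auto
      then have "l < next_row Dh r \<or> next_row Dh r < l" by linarith
      \<comment> \<open>With \<open>lt\<close>, a label before \<open>next_row Dh r\<close> would
        receive \<open>Plus\<close>; hence \<open>l\<close> lies beyond it and the conditions must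
        fail.\<close>
      then have "\<not> cond_ii Dh r l" "\<not> cond_iii Dh r l"
        using zero_l lt l(3)
        by (auto simp: type_I_III_entry_def Let_def split: if_splits)
      then show ?thesis using restricted_zero_if_not_conds less_imp_le by blast
    qed
  qed
  have no_plus_above: "\<not> (\<exists>i'<i. plus_at ?D i' j)"
    if zero: "zero_at ?D i j" and left: "\<exists>j'>j. plus_at ?D i j'" for i j
  proof
    assume "\<exists>i'<i. plus_at ?D i' j"
    then obtain i' where i': "i' < i" "plus_at ?D i' j" by blast
    obtain b where b: "b \<ge> i" "restricted_zero Dh b j" using blocked[OF zero] left by blast
    have "i \<in> new_rows Dh" "i < j" using zero by (auto simp: zero_at_def box')
    \<comment> \<open>Row \<open>i\<close> lies below \<open>i'\<close>, so
      \<open>next_row Dh i' \<le> i < j\<close>.\<close>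
    then have "next_row Dh i' \<le> j" using next_row_le[OF _ i'(1)] by fastforce
    then have "new_entry Dh i' j = Zero"
      using new_entry_above_restricted_zero[OF assms(2) b(2)] b(1) i'(1) by simp
    then show False using i'(2) by (simp add: plus_at_def entry')
  qed
  show ?thesis
    unfolding le_diagram_def
  proof (intro conjI allI impI notI)
    fix i j
    assume "zero_at ?D i j" "(\<exists>i'<i. plus_at ?D i' j) \<and> (\<exists>j'>j. plus_at ?D i j')"
    then show False using no_plus_above by blast
  qed (rule steps' fits')+
qed

end
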